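(* Let $\mathbb{K}$ be $\mathbb{R}$ or $\mathbb{C}$. Let $X$ be a set of infinite cardinality $\kappa$, where $\kappa=\kappa^\omega$. Let $I$ be a subset of $\mathbb{K}$ with nonempty interior in $\mathbb{K}$. Let $\mathcal{F}_1,\mathcal{F}_2$ be families of subsets of $X$ such that, for $i=1,2$, $|\mathcal{F}_i|=\kappa$ and $|F|=\kappa$ for every $F\in\mathcal{F}_i$. Suppose that there is a set $F_2\in\mathcal{F}_2$ such that $|F_1\setminus F_2|=\kappa$ for every $F_1\in\mathcal{F}_1$. Then the family $\mathcal{SES}(I,\mathcal{F}_1)\setminus\mathcal{SES}(I,\mathcal{F}_2)\subset\mathbb{K}^X$ is strongly $2^\kappa$-algebrable.
   Context: $\mathbb{K}^X$ is the commutative $\mathbb{K}$-algebra of all functions $X\to\mathbb{K}$ with pointwise operations. For $\mathcal{F}\subset\mathcal{P}(X)$ and $I\subset\mathbb{K}$, $\mathcal{SES}(I,\mathcal{F})$ (the $I$-strongly everywhere surjective functions with respect to $\mathcal{F}$) is the set of all $f\in\mathbb{K}^X$ such that for every $F\in\mathcal{F}$ there are $n\in\mathbb{N}$, $n\ge 1$, and a non-constant polynomial $P$ in $n$ variables over $\mathbb{K}$ with $f(F)=P(I^n)$, and moreover $|\{x\in F:f(x)=y\}|=|X|$ for every $y\in f(F)$. A subset $E$ of a commutative algebra $A$ is strongly $\lambda$-algebrable if $E\cup\{0\}$ contains a free algebra with $\lambda$ free generators; equivalently, there is $Y\subset E$ with $|Y|=\lambda$ such that for every $n\geq1$, every nonzero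 polynomial $P$ in $n$ variables without constant term and all distinct $y_1,\dots,y_n\in Y$ one has $P(y_1,\dots,y_n)\in E\setminus\{0\}$. *)

theory Defs
  imports "HOL-Analysis.Analysis" "HOL-Library.Poly_Mapping"
begin

unbundle cardinal_syntax

(* A monomial is its finitely supported family of exponents, indexed by the variables
   0, 1, 2, ...; a polynomial is its finitely supported family of coefficients. *)
type_synonym 'k mpoly = "(nat \<Rightarrow>\<^sub>0 nat) \<Rightarrow>\<^sub>0 'k"

definition polys :: "nat \<Rightarrow> 'k::comm_ring_1 mpoly set" where
  "polys n = {P. \<forall>m \<in> Poly_Mapping.keys P. Poly_Mapping.keys m \<subseteq> {..<n}}"

definition nonconstant :: "'k::comm_ring_1 mpoly \<Rightarrow> bool" where
  "nonconstant P \<longleftrightarrow> (\<exists>m \<in> Poly_Mapping.keys P. m \<noteq> 0)"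

definition const_term :: "'k::comm_ring_1 mpoly \<Rightarrow> 'k" where
  "const_term P = Poly_Mapping.lookup P 0"

definition eval_poly :: "'k::comm_ring_1 mpoly \<Rightarrow> (nat \<Rightarrow> 'k) \<Rightarrow> 'k" where
  "eval_poly P a =
     (\<Sum>m \<in> Poly_Mapping.keys P. Poly_Mapping.lookup P m *
        (\<Prod>i \<in> Poly_Mapping.keys m. a i ^ Poly_Mapping.lookup m i))"

(* Functions on the set X are represented as elements of X \<rightarrow>\<^sub>E UNIV. *)
definition SES :: "'a set \<Rightarrow> 'k::comm_ring_1 set \<Rightarrow> 'a set set \<Rightarrow> ('a \<Rightarrow> 'k) set" where
  "SES X I \<F> = {f \<in> X \<rightarrow>\<^sub>E UNIV. \<forall>F \<in> \<F>.
     (\<exists>n\<ge>1. \<exists>P \<in> polys n. nonconstant P \<and> f ` F = eval_poly P ` ({..<n} \<rightarrow>\<^sub>E I)) \<and>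
     (\<forall>y \<in> f ` F. |{x \<in> F. f x = y}| =o |X| )}"

(* P(y_1,...,y_n) in the algebra of functions on X with pointwise operations. *)
definition eval_poly_fun ::
    "'a set \<Rightarrow> 'k::comm_ring_1 mpoly \<Rightarrow> (nat \<Rightarrow> 'a \<Rightarrow> 'k) \<Rightarrow> 'a \<Rightarrow> 'k" where
  "eval_poly_fun X P y = (\<lambda>x\<in>X. eval_poly P (\<lambda>i. y i x))"

(* Strong r-algebrability, for a cardinal r, of a subset E of the algebra of functions on X.
   Y is the set of free generators; the algebra they generate has no unit adjoined, whence
   the polynomials without constant term. *)
definition strongly_algebrable ::
    "'a set \<Rightarrow> 'c rel \<Rightarrow> ('a \<Rightarrow> 'k::comm_ring_1) set \<Rightarrow> bool" where
  "strongly_algebrable X r E \<longleftrightarrow> E \<subseteq> X \<rightarrow>\<^sub>E UNIV \<and>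
     (\<exists>Y \<subseteq> E. |Y| =o r \<and>
        (\<forall>n\<ge>1. \<forall>P \<in> polys n. \<forall>y.
           P \<noteq> 0 \<and> const_term P = 0 \<and> inj_on y {..<n} \<and> y ` {..<n} \<subseteq> Y \<longrightarrow>
           eval_poly_fun X P y \<in> E - {\<lambda>x\<in>X. 0}))"

end

theory Submission
  imports Defs
begin

text \<open>Choose pairwise disjoint sets of size \<open>|X|\<close> inside the sets \<open>F - F\<^sub>2\<close>, \<open>F \<in> \<F>\<^sub>1\<close>, and
  put on each of them a copy of an independent family of \<open>2^|X|\<close> functions with values in \<open>I\<close>:
  every choice of values \<open>a\<^sub>1, ..., a\<^sub>n \<in> I\<close> for finitely many members of the family is attained
  at \<open>|X|\<close> points. Elsewhere, in particular on \<open>F\<^sub>2\<close>, all functions take one value \<open>c \<in> I\<close>.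
  Then \<open>P(f\<^sub>1, ..., f\<^sub>n)\<close> maps every \<open>F \<in> \<F>\<^sub>1\<close> onto \<open>P(I^n)\<close> with fibres of size \<open>|X|\<close>, but is
  constant on \<open>F\<^sub>2\<close>, whereas a nonconstant polynomial is not constant on \<open>I^m\<close>.\<close>

section \<open>Injective choice from large sets\<close>

text \<open>Recursion along the cardinal well-order \<open>|J|\<close>: every proper initial segment
  is smaller than \<open>J\<close>, so the values already taken never exhaust
  \<open>S j\<close>.\<close>

lemma inj_choice:
  assumes "\<And>j. j \<in> J \<Longrightarrow> |J| \<le>o |S j|"
  shows "\<exists>g. inj_on g J \<and> (\<forall>j\<in>J. g j \<in> S j)"
proof -
  let ?r = "|J|"
  have wo: "well_order_on J ?r" by (rule card_of_well_order_on)
  then have "wf (?r - Id)" by (simp add: well_order_on_def)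
  then have "\<exists>g. \<forall>j. j \<in> J \<longrightarrow> g j \<in> S j - g ` underS ?r j"
  proof (rule dependent_wf_choice[where P = "\<lambda>g j x. j \<in> J \<longrightarrow> x \<in> S j - g ` underS ?r j"])
    fix f g :: "'a \<Rightarrow> 'b" and j x
    assume "\<And>z. (z, j) \<in> ?r - Id \<Longrightarrow> f z = g z"
    then have "f ` underS ?r j = g ` underS ?r j"
      by (intro image_cong) (auto simp: underS_def)
    then show "(j \<in> J \<longrightarrow> x \<in> S j - f ` underS ?r j) = (j \<in> J \<longrightarrow> x \<in> S j - g ` underS ?r j)"
      by simp
  next
    fix j and g :: "'a \<Rightarrow> 'b"
    show "\<exists>x. j \<in> J \<longrightarrow> x \<in> S j - g ` underS ?r j"
    proof (cases "j \<in> J")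
      case True
      have "|g ` underS ?r j| \<le>o |underS ?r j|" by (rule card_of_image)
      moreover have "|underS ?r j| <o ?r"
        using True by (intro card_of_underS card_of_Card_order) (simp add: Field_card_of)
      ultimately have "|g ` underS ?r j| <o |S j|"
        using assms[OF True] ordLeq_ordLess_trans ordLess_ordLeq_trans by blast
      then have "\<not> S j \<subseteq> g ` underS ?r j"
        using card_of_mono1 not_ordLess_ordLeq by blast
      then show ?thesis by blast
    qed simp
  qed
  then obtain g where g: "\<And>j. j \<in> J \<Longrightarrow> g j \<in> S j - g ` underS ?r j" by blast
  have "inj_on g J"
  proof (rule inj_onI, rule ccontr)
    fix i j assume ij: "i \<in> J" "j \<in> J" "g i = g j" "i \<noteq> j"
    then have "i \<in> underS ?r j \<or> j \<in> underS ?r i"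
      using wo by (auto simp: underS_def well_order_on_def linear_order_on_def total_on_def)
    then show False using g ij(1-3) by (metis DiffD2 imageI)
  qed
  then show ?thesis using g by blast
qed

section \<open>Polynomials on boxes over an infinite set\<close>

text \<open>Induction on the number of variables: once the other variables are fixed in
  \<open>I\<close>, the sum is a univariate polynomial with infinitely many roots, hence zero, and
  its coefficients are sums of the same form in one variable less.\<close>

lemma vanishing_on_box_imp_coeffs_zero:
  fixes c :: "'m \<Rightarrow> 'k::idom" and e :: "'m \<Rightarrow> nat \<Rightarrow> nat"
  assumes "infinite I" "finite M"
    and "\<And>m m'. m \<in> M \<Longrightarrow> m' \<in> M \<Longrightarrow> (\<forall>i<n. e m i = e m' i) \<Longrightarrow> m = m'"
    and "\<And>a. (\<forall>i<n. a i \<in> I) \<Longrightarrow> (\<Sum>m\<in>M. c m * (\<Prod>i<n. a i ^ e m i)) = 0"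
    and "m \<in> M"
  shows "c m = 0"
  using assms(2-)
proof (induction n arbitrary: M)
  case 0
  then have "M = {m}" by auto
  then show ?case using "0.prems"(3)[of "\<lambda>_. undefined"] by simp
next
  case (Suc n)
  \<comment> \<open>These are the indices contributing to the coefficient of degree
    \<open>e m n\<close>. They agree in the last exponent, so the first \<open>n\<close> exponents
    already separate them.\<close>
  let ?M = "{m' \<in> M. e m' n = e m n}"
  show ?case
  proof (rule Suc.IH[of ?M])
    fix a :: "nat \<Rightarrow> 'k" assume a: "\<forall>i<n. a i \<in> I"
    let ?t = "\<lambda>m. c m * (\<Prod>i<n. a i ^ e m i)"
    define q where "q = (\<Sum>m\<in>M. monom (?t m) (e m n))"
    have "poly q z = 0" if "z \<in> I" for z
    proof -
      have "poly q z = (\<Sum>m\<in>M. c m * (\<Prod>i<Suc n. (a(n := z)) i ^ e m i))"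
        by (simp add: q_def poly_sum poly_monom mult.assoc)
      also have "\<dots> = 0" using a that by (intro Suc.prems(3)) (auto simp: less_Suc_eq)
      finally show ?thesis .
    qed
    then have "I \<subseteq> {z. poly q z = 0}" by blast
    then have "q = 0" using assms(1) poly_roots_finite[of q] finite_subset by blast
    then have "0 = coeff q (e m n)" by simp
    also have "\<dots> = (\<Sum>m'\<in>M. if e m' n = e m n then ?t m' else 0)"
      by (simp add: q_def coeff_sum)
    also have "\<dots> = sum ?t ?M"
      using Suc.prems(1) by (simp add: sum.inter_filter)
    finally show "sum ?t ?M = 0" by simp
  next
    fix m1 m2 assume "m1 \<in> ?M" "m2 \<in> ?M" "\<forall>i<n. e m1 i = e m2 i"
    then show "m1 = m2" by (intro Suc.prems(2)) (auto simp: less_Suc_eq)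
  qed (use Suc.prems in auto)
qed

lemma eval_poly_eq:
  assumes "P \<in> polys n"
  shows "eval_poly P a =
    (\<Sum>m \<in> Poly_Mapping.keys P. Poly_Mapping.lookup P m * (\<Prod>i<n. a i ^ Poly_Mapping.lookup m i))"
  unfolding eval_poly_def
proof (rule sum.cong)
  fix m assume "m \<in> Poly_Mapping.keys P"
  then have "Poly_Mapping.keys m \<subseteq> {..<n}" using assms by (auto simp: polys_def)
  then have "(\<Prod>i\<in>Poly_Mapping.keys m. a i ^ Poly_Mapping.lookup m i)
      = (\<Prod>i<n. a i ^ Poly_Mapping.lookup m i)"
    by (intro prod.mono_neutral_left) (auto simp: in_keys_iff)
  then show "Poly_Mapping.lookup P m * (\<Prod>i\<in>Poly_Mapping.keys m. a i ^ Poly_Mapping.lookup m i)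
      = Poly_Mapping.lookup P m * (\<Prod>i<n. a i ^ Poly_Mapping.lookup m i)" by simp
qed simp

lemma eval_poly_cong:
  assumes "P \<in> polys n" "\<And>i. i < n \<Longrightarrow> a i = b i"
  shows "eval_poly P a = eval_poly P b"
  using assms(2) by (simp add: eval_poly_eq[OF assms(1)])

text \<open>Otherwise \<open>P - d\<close> vanishes on the box and has only zero coefficients, but
  subtracting \<open>d\<close> leaves the coefficient of a nonconstant monomial unchanged.\<close>

lemma nonconstant_not_constant_on_box:
  fixes P :: "'k::idom mpoly"
  assumes "infinite I" "P \<in> polys n" "nonconstant P"
  shows "\<exists>a \<in> {..<n} \<rightarrow>\<^sub>E I. eval_poly P a \<noteq> d"
proof (rule ccontr)
  assume *: "\<not> ?thesis"
  obtain m0 where m0: "m0 \<in> Poly_Mapping.keys P" "m0 \<noteq> 0"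
    using assms(3) by (auto simp: nonconstant_def)
  \<comment> \<open>The monomial \<open>0\<close> may be missing from the keys of \<open>P\<close>,
    yet it has to carry \<open>- d\<close>.\<close>
  let ?M = "insert 0 (Poly_Mapping.keys P)"
  let ?c = "\<lambda>m. Poly_Mapping.lookup P m - (if m = 0 then d else 0)"
  have "?c m0 = 0"
  proof (rule vanishing_on_box_imp_coeffs_zero[OF assms(1), where M = ?M and n = n and e = Poly_Mapping.lookup and c = ?c and m = m0])
    fix m m' assume "m \<in> ?M" "m' \<in> ?M"
      and eq: "\<forall>i<n. Poly_Mapping.lookup m i = Poly_Mapping.lookup m' i"
    then have "Poly_Mapping.keys m \<subseteq> {..<n}" "Poly_Mapping.keys m' \<subseteq> {..<n}"
      using assms(2) by (auto simp: polys_def)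
    then have "Poly_Mapping.lookup m i = Poly_Mapping.lookup m' i" for i
      using eq by (cases "i < n") (simp, metis in_keys_iff lessThan_iff subsetD)
    then show "m = m'" by (simp add: poly_mapping_eqI)
  next
    fix a :: "nat \<Rightarrow> 'k" assume a: "\<forall>i<n. a i \<in> I"
    let ?p = "\<lambda>m. \<Prod>i<n. a i ^ Poly_Mapping.lookup m i"
    have "(\<Sum>m\<in>?M. ?c m * ?p m)
        = (\<Sum>m\<in>?M. Poly_Mapping.lookup P m * ?p m) - (\<Sum>m\<in>?M. if m = 0 then d * ?p m else 0)"
      by (simp only: sum_subtractf[symmetric]) (intro sum.cong, auto simp: algebra_simps)
    also have "(\<Sum>m\<in>?M. if m = 0 then d * ?p m else 0) = d"
      by (subst sum.delta) auto
    also have "(\<Sum>m\<in>?M. Poly_Mapping.lookup P m * ?p m)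
        = (\<Sum>m\<in>Poly_Mapping.keys P. Poly_Mapping.lookup P m * ?p m)"
      by (rule sum.mono_neutral_right) (auto simp: in_keys_iff)
    also have "\<dots> = eval_poly P (restrict a {..<n})"
      unfolding eval_poly_eq[OF assms(2)] by simp
    also have "\<dots> = d" using * a by (auto simp: restrict_PiE_iff)
    finally show "(\<Sum>m\<in>?M. ?c m * ?p m) = 0" by simp
  qed (use m0 in auto)
  then show False using m0 by (simp add: in_keys_iff)
qed

lemma nonconstantI: "P \<noteq> 0 \<Longrightarrow> const_term P = 0 \<Longrightarrow> nonconstant P"
  by (metis all_not_in_conv const_term_def in_keys_iff keys_eq_empty nonconstant_def)

section \<open>Cardinal bounds from \<kappa> = \<kappa>^\<omega>\<close>

lemma card_of_Func_nat_ordLeq: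
  assumes "|X| =o |X| ^c natLeq" "infinite X" "|B| \<le>o |X|"
  shows "|Func (UNIV :: nat set) B| \<le>o |X|"
proof -
  have "|B| ^c natLeq \<le>o |X| ^c natLeq"
    by (rule cexp_mono1[OF assms(3) natLeq_Card_order])
  then have "|B| ^c natLeq \<le>o |X|"
    using assms(1) ordIso_symmetric ordLeq_ordIso_trans by blast
  then show ?thesis by (simp add: cexp_def Field_natLeq Field_card_of)
qed

lemma card_of_finite_ordLeq_infinite: "finite A \<Longrightarrow> infinite B \<Longrightarrow> |A| \<le>o |B|"
  using ordLeq_total[OF card_of_Well_order card_of_Well_order] card_of_ordLeq_finite by blast

lemma card_of_nat_set_ordLeq:
  assumes "|X| =o |X| ^c natLeq" "infinite X"
  shows "|UNIV :: nat set set| \<le>o |X|"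
proof -
  have "|UNIV :: nat set set| \<le>o |Func (UNIV :: nat set) (UNIV :: bool set)|"
    by (rule card_of_ordLeqI[where f = "\<lambda>A i. i \<in> A"]) (auto simp: inj_on_def fun_eq_iff Func_def)
  moreover have "|Func (UNIV :: nat set) (UNIV :: bool set)| \<le>o |X|"
    by (intro card_of_Func_nat_ordLeq assms card_of_finite_ordLeq_infinite) auto
  ultimately show ?thesis by (rule ordLeq_transitive)
qed

text \<open>Dedekind cuts: a real is determined by the rationals below it, here enumerated by
  \<open>from_nat\<close>.\<close>

lemma card_of_real_ordLeq_nat_set: "|UNIV :: real set| \<le>o |UNIV :: nat set set|"
proof (rule card_of_ordLeqI[where f = "\<lambda>x. {n. of_rat (from_nat n) < x}"])
  show "inj_on (\<lambda>x::real. {n. of_rat (from_nat n) < x}) UNIV"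
  proof (rule linorder_injI)
    fix x y :: real assume "x < y"
    then obtain q where q: "x < of_rat q" "of_rat q < y" using of_rat_dense by blast
    then have "to_nat q \<in> {n. of_rat (from_nat n) < y} - {n. of_rat (from_nat n) < x}" by simp
    then show "{n. of_rat (from_nat n) < x} \<noteq> {n. of_rat (from_nat n) < y}" by blast
  qed
qed auto

lemma card_of_complex_ordLeq:
  assumes "infinite X" "|UNIV :: real set| \<le>o |X|"
  shows "|UNIV :: complex set| \<le>o |X|"
proof -
  have "|UNIV :: complex set| \<le>o |(UNIV :: real set) \<times> (UNIV :: real set)|"
    by (rule card_of_ordLeqI[where f = "\<lambda>z. (Re z, Im z)"]) (auto simp: inj_on_def complex_eq_iff)
  moreover have "|(UNIV :: real set) \<times> (UNIV :: real set)| \<le>o |X|"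
    by (rule card_of_Sigma_ordLeq_infinite) (use assms in auto)
  finally show ?thesis .
qed

section \<open>An independent family of functions indexed by the subsets of \<open>X\<close>\<close>

text \<open>The set \<open>t\<close> is recognised by its trace on the sequence \<open>d\<close>, which \<open>s\<close> compares
  with a sequence of traces; \<open>v\<close> lists the values. If no trace matches, \<open>LEAST\<close> is unspecified,
  but the value is still an entry of \<open>v\<close>.\<close>

definition trace_value :: "'a set \<Rightarrow> 'a \<times> (nat \<Rightarrow> 'a) \<times> (nat \<Rightarrow> nat set) \<times> (nat \<Rightarrow> 'k) \<Rightarrow> 'k" where
  "trace_value t = (\<lambda>(x, d, s, v). v (LEAST k. {j. d j \<in> t} = s k))"

definition trace_points ::
    "'a set \<Rightarrow> 'k set \<Rightarrow> ('a \<times> (nat \<Rightarrow> 'a) \<times> (nat \<Rightarrow> nat set) \<times> (nat \<Rightarrow> 'k)) set" where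
  "trace_points X I = X \<times> Func UNIV X \<times> Func UNIV UNIV \<times> Func UNIV I"

lemma trace_value_mem: "p \<in> trace_points X I \<Longrightarrow> trace_value t p \<in> I"
  by (auto simp: trace_value_def trace_points_def Func_def)

text \<open>Finitely many distinct sets are told apart by finitely many points, which fit into one
  sequence \<open>d\<close>. The component \<open>x\<close> stays free, so that each prescription of
  values is met once for every point of \<open>X\<close>.\<close>

lemma trace_value_independent:
  fixes a :: "nat \<Rightarrow> 'k" and X :: "'a set"
  assumes "X \<noteq> {}" "c \<in> I" and t: "\<And>i. i < n \<Longrightarrow> t i \<subseteq> X" "inj_on t {..<n}"
    and a: "\<And>i. i < n \<Longrightarrow> a i \<in> I"
  shows "\<exists>d s v. (\<forall>x\<in>X. (x, d, s, v) \<in> trace_points X I) \<and>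
    (\<forall>x. \<forall>i<n. trace_value (t i) (x, d, s, v) = a i)"
proof -
  obtain x0 where x0: "x0 \<in> X" using assms(1) by blast
  \<comment> \<open>A point of the symmetric difference of \<open>t i\<close> and
    \<open>t j\<close>; for all other pairs \<open>x0\<close> is a dummy.\<close>
  have "\<exists>z\<in>X. i < n \<longrightarrow> j < n \<longrightarrow> i \<noteq> j \<longrightarrow> (z \<in> t i) \<noteq> (z \<in> t j)" for i j
  proof (cases "i < n \<and> j < n \<and> i \<noteq> j")
    case True
    then have "t i \<noteq> t j" using t(2) by (auto simp: inj_on_def)
    then show ?thesis using True t(1) by blast
  qed (use x0 in auto)
  then obtain h where h: "\<And>i j. h i j \<in> X"
    "\<And>i j. i < n \<Longrightarrow> j < n \<Longrightarrow> i \<noteq> j \<Longrightarrow> (h i j \<in> t i) \<noteq> (h i j \<in> t j)"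
    by metis
  define d where "d k = (case prod_decode k of (i, j) \<Rightarrow> h i j)" for k
  define s where "s i = {j. d j \<in> t i}" for i
  \<comment> \<open>The default \<open>c\<close> keeps every entry of \<open>v\<close> in
    \<open>I\<close>.\<close>
  define v where "v i = (if i < n then a i else c)" for i
  have s: "s i \<noteq> s j" if "i < n" "j < n" "i \<noteq> j" for i j
  proof -
    have "d (prod_encode (i, j)) = h i j" by (simp add: d_def)
    then have "(prod_encode (i, j) \<in> s i) \<noteq> (prod_encode (i, j) \<in> s j)"
      using h(2)[OF that] by (simp add: s_def)
    then show ?thesis by auto
  qed
  have "(x, d, s, v) \<in> trace_points X I" if "x \<in> X" for x
    using that h(1) a assms(2)
    by (auto simp: trace_points_def Func_def d_def v_def split: prod.split)
  moreover have "trace_value (t i) (x, d, s, v) = a i" if i: "i < n" for x i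
  proof -
    \<comment> \<open>Only the first \<open>n\<close> traces are known to be distinct. A later one
      may repeat \<open>s i\<close>, but \<open>LEAST\<close> picks the first match.\<close>
    have "(LEAST k. s i = s k) = i"
    proof (rule Least_equality)
      fix k assume "s i = s k"
      then show "i \<le> k" using s[OF i, of k] i by (cases "k < n") auto
    qed simp
    then show ?thesis using i by (simp add: trace_value_def v_def flip: s_def)
  qed
  ultimately show ?thesis by blast
qed

lemma card_of_trace_points:
  assumes "|X| =o |X| ^c natLeq" "infinite X" "|I| \<le>o |X|"
  shows "|trace_points X I| \<le>o |X|"
  unfolding trace_points_def
  by (intro card_of_Sigma_ordLeq_infinite ballI card_of_Func_nat_ordLeq assms
      card_of_nat_set_ordLeq ordLeq_refl card_of_Card_order)

section \<open>Construction of the free generators\<close>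

text \<open>Asking of \<open>I\<close> only that it is infinite and of size at most
  \<open>|X|\<close> lets one argument over an integral domain serve both real and complex
  scalars.\<close>

lemma strongly_algebrable_SES_Diff:
  fixes X :: "'a set" and I :: "'k::idom set"
  assumes X: "infinite X" "|X| =o |X| ^c natLeq"
    and sub: "\<F>1 \<subseteq> Pow X" "F2 \<subseteq> X" and F2: "F2 \<in> \<F>2" "F2 \<noteq> {}"
    and card1: "|\<F>1| \<le>o |X|" "\<F>1 \<noteq> {}"
    and diff: "\<And>F. F \<in> \<F>1 \<Longrightarrow> |F - F2| =o |X|"
    and I: "infinite I" "|I| \<le>o |X|"
  shows "strongly_algebrable X (ctwo ^c |X| ) (SES X I \<F>1 - SES X I \<F>2)"
proof -
  obtain c where c: "c \<in> I" using infinite_imp_nonempty[OF I(1)] by blast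
  let ?Q = "trace_points X I"
  let ?J = "\<F>1 \<times> ?Q"
  have J: "|?J| \<le>o |X|"
    by (intro card_of_Sigma_ordLeq_infinite ballI card_of_trace_points X I card1)
  have "|?J| \<le>o |fst j - F2|" if "j \<in> ?J" for j
    using that by (intro ordLeq_ordIso_trans[OF J] ordIso_symmetric[OF diff]) auto
  \<comment> \<open>Every pair of a set \<open>F\<close> and a code point gets its own point of
    \<open>F - F2\<close>, so the copies are disjoint even where members of \<open>\<F>1\<close>
    overlap.\<close>
  then obtain g where g: "inj_on g ?J" "\<And>j. j \<in> ?J \<Longrightarrow> g j \<in> fst j - F2"
    using inj_choice[of ?J "\<lambda>j. fst j - F2"] by blast
  \<comment> \<open>\<open>snd\<close> forgets \<open>F\<close>, so each copy carries the same
    function \<open>trace_value t\<close>.\<close>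
  define f where "f t = (\<lambda>x\<in>X. if x \<in> g ` ?J then trace_value t (snd (inv_into ?J g x)) else c)" for t
  have gX: "g (F, p) \<in> X" if "F \<in> \<F>1" "p \<in> ?Q" for F p
    using g(2)[of "(F, p)"] that sub(1) by auto
  have fg: "f t (g (F, p)) = trace_value t p" if "F \<in> \<F>1" "p \<in> ?Q" for t F p
    using that gX[OF that] g(1) by (simp add: f_def inv_into_f_f)
  have fI: "f t x \<in> I" if "x \<in> X" for t x
  proof (cases "x \<in> g ` ?J")
    case True
    then show ?thesis using gX fg trace_value_mem by fastforce
  qed (use that c in \<open>simp add: f_def\<close>)
  have f2: "f t x = c" if "x \<in> F2" for t x
    using that g(2) sub(2) by (fastforce simp: f_def)
  have FX: "x \<in> X" if "x \<in> F" "F \<in> \<F>1" for x F using that sub(1) by blast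
  have ne: "B \<noteq> {}" if "|B| =o |X|" for B :: "'a set"
    using X(1) card_of_ordIso_finite[OF that] by auto
  have Xne: "X \<noteq> {}" using X(1) by auto
  have indep: "\<exists>B \<subseteq> F. |B| =o |X| \<and> (\<forall>x\<in>B. \<forall>i<n. f (t i) x = a i)"
    if F: "F \<in> \<F>1" and t: "\<And>i. i < n \<Longrightarrow> t i \<subseteq> X" "inj_on t {..<n}"
      and a: "\<And>i. i < n \<Longrightarrow> a i \<in> I" for F n t and a :: "nat \<Rightarrow> 'k"
  proof -
    obtain d s v where dsv: "\<And>x. x \<in> X \<Longrightarrow> (x, d, s, v) \<in> ?Q"
      "\<And>x i. i < n \<Longrightarrow> trace_value (t i) (x, d, s, v) = a i"
      using trace_value_independent[where t = t and a = a, OF Xne c t a] by blast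
    \<comment> \<open>Only the first component varies, which \<open>trace_value\<close> ignores:
      this yields \<open>|X|\<close> points with the same values.\<close>
    let ?k = "\<lambda>x. g (F, x, d, s, v)"
    have "inj_on ?k X"
    proof (rule inj_onI)
      fix x y assume "x \<in> X" "y \<in> X" "?k x = ?k y"
      then show "x = y"
        using inj_onD[OF g(1), of "(F, x, d, s, v)" "(F, y, d, s, v)"] dsv(1) F by simp
    qed
    then have "|?k ` X| =o |X|"
      by (meson card_of_ordIsoI inj_on_imp_bij_betw ordIso_symmetric)
    moreover have "?k ` X \<subseteq> F" using g(2) dsv(1) F by force
    moreover have "\<forall>x\<in>?k ` X. \<forall>i<n. f (t i) x = a i" using fg F dsv by auto
    ultimately show ?thesis by blast
  qed
  \<comment> \<open>Stated for nonconstant \<open>P\<close> with any constant term; a zero constant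
    term serves later to derive nonconstancy from \<open>P \<noteq> 0\<close>.\<close>
  have main: "eval_poly_fun X P (\<lambda>i. f (t i)) \<in> SES X I \<F>1 - SES X I \<F>2 - {\<lambda>x\<in>X. 0}"
    if n: "n \<ge> 1" and P: "P \<in> polys n" "nonconstant P"
      and t: "\<And>i. i < n \<Longrightarrow> t i \<subseteq> X" "inj_on t {..<n}" for n t and P :: "'k mpoly"
  proof -
    let ?h = "eval_poly_fun X P (\<lambda>i. f (t i))"
    let ?B = "{..<n} \<rightarrow>\<^sub>E I"
    have mem: "?h \<in> X \<rightarrow>\<^sub>E UNIV" by (simp add: eval_poly_fun_def)
    have sub_img: "?h x \<in> eval_poly P ` ?B" if "x \<in> X" for x
    proof
      show "?h x = eval_poly P (\<lambda>i\<in>{..<n}. f (t i) x)"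
        using that by (auto simp: eval_poly_fun_def intro: eval_poly_cong[OF P(1)])
      show "(\<lambda>i\<in>{..<n}. f (t i) x) \<in> ?B" using fI[OF that] by auto
    qed
    have fiber: "\<exists>B \<subseteq> {x \<in> F. ?h x = eval_poly P a}. |B| =o |X|"
      if F: "F \<in> \<F>1" and a: "a \<in> ?B" for F a
    proof -
      obtain B where B: "B \<subseteq> F" "|B| =o |X|" "\<forall>x\<in>B. \<forall>i<n. f (t i) x = a i"
        using indep[where n = n and t = t and a = a, OF F t] a by (auto simp: PiE_iff)
      have "?h x = eval_poly P a" if "x \<in> B" for x
        using that B FX[OF _ F] by (auto simp: eval_poly_fun_def intro!: eval_poly_cong[OF P(1)])
      then show ?thesis using B by blast
    qed
    have img: "?h ` F = eval_poly P ` ?B" if F: "F \<in> \<F>1" for F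
    proof
      show "?h ` F \<subseteq> eval_poly P ` ?B" using F sub(1) sub_img by blast
      show "eval_poly P ` ?B \<subseteq> ?h ` F"
      proof clarify
        fix a assume "a \<in> ?B"
        then obtain B where B: "B \<subseteq> {x \<in> F. ?h x = eval_poly P a}" "|B| =o |X|"
          using fiber[OF F] by blast
        then show "eval_poly P a \<in> ?h ` F" using ne[OF B(2)] by force
      qed
    qed
    have fibers: "|{x \<in> F. ?h x = y}| =o |X|" if F: "F \<in> \<F>1" and y: "y \<in> ?h ` F" for F y
    proof -
      obtain a where "a \<in> ?B" "y = eval_poly P a" using y img[OF F] by blast
      then obtain B where B: "B \<subseteq> {x \<in> F. ?h x = y}" "|B| =o |X|" using fiber[OF F] by blast
      have "|X| \<le>o |{x \<in> F. ?h x = y}|"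
        by (rule ordIso_ordLeq_trans[OF ordIso_symmetric[OF B(2)] card_of_mono1[OF B(1)]])
      moreover have "|{x \<in> F. ?h x = y}| \<le>o |X|"
        using FX[OF _ F] by (intro card_of_mono1) auto
      ultimately show ?thesis by (simp add: ordIso_iff_ordLeq)
    qed
    have 1: "?h \<in> SES X I \<F>1"
      unfolding SES_def mem_Collect_eq
    proof (intro conjI ballI mem)
      show "\<exists>n\<ge>1. \<exists>P \<in> polys n. nonconstant P \<and> ?h ` F = eval_poly P ` ({..<n} \<rightarrow>\<^sub>E I)"
        if "F \<in> \<F>1" for F
        using n P img[OF that] by blast
    qed (rule fibers)
    have 2: "?h \<notin> SES X I \<F>2"
    proof
      assume "?h \<in> SES X I \<F>2"
      then obtain m R where R: "R \<in> polys m" "nonconstant R"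
        "?h ` F2 = eval_poly R ` ({..<m} \<rightarrow>\<^sub>E I)"
        using F2(1) by (auto simp: SES_def)
      have *: "?h x = eval_poly P (\<lambda>_. c)" if "x \<in> F2" for x
        using that sub(2) f2[OF that] by (auto simp: eval_poly_fun_def)
      have "eval_poly R a = eval_poly P (\<lambda>_. c)" if "a \<in> {..<m} \<rightarrow>\<^sub>E I" for a
      proof -
        have "eval_poly R a \<in> ?h ` F2" using that by (simp add: R(3))
        then obtain x where "eval_poly R a = ?h x" "x \<in> F2" by (rule imageE)
        then show ?thesis using *[of x] by simp
      qed
      then show False using nonconstant_not_constant_on_box[OF I(1) R(1,2)] by blast
    qed
    have 3: "?h \<noteq> (\<lambda>x\<in>X. 0)"
    proof
      assume z: "?h = (\<lambda>x\<in>X. 0)"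
      obtain F where F: "F \<in> \<F>1" using card1(2) by blast
      then have *: "?h x = 0" if "x \<in> F" for x using that FX z by auto
      have "eval_poly P a = 0" if "a \<in> ?B" for a
      proof -
        have "eval_poly P a \<in> ?h ` F" using that by (simp add: img[OF F])
        then obtain x where "eval_poly P a = ?h x" "x \<in> F" by (rule imageE)
        then show ?thesis using *[of x] by simp
      qed
      then show False using nonconstant_not_constant_on_box[OF I(1) P] by blast
    qed
    from 1 2 3 show ?thesis by blast
  qed
  have fE: "f t \<in> SES X I \<F>1 - SES X I \<F>2" if "t \<subseteq> X" for t
  proof -
    \<comment> \<open>The polynomial consisting of the single variable 0, for which
      \<open>main\<close> with \<open>n = 1\<close> speaks about \<open>f t\<close> itself.\<close>
    let ?P = "Poly_Mapping.single (Poly_Mapping.single 0 1) 1 :: 'k mpoly"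
    have "Poly_Mapping.single (0::nat) (1::nat) \<noteq> 0"
      by (metis lookup_single_eq lookup_zero one_neq_zero)
    then have "nonconstant ?P" by (simp add: nonconstant_def)
    then have "eval_poly_fun X ?P (\<lambda>_. f t) \<in> SES X I \<F>1 - SES X I \<F>2 - {\<lambda>x\<in>X. 0}"
      by (intro main[of 1]) (use that in \<open>auto simp: polys_def inj_on_def\<close>)
    moreover have "eval_poly_fun X ?P (\<lambda>_. f t) = f t"
      by (auto simp: eval_poly_fun_def eval_poly_def f_def)
    ultimately show ?thesis by simp
  qed
  have inj: "inj_on f (Pow X)"
  proof (rule inj_onI, rule ccontr)
    fix t u assume tu: "t \<in> Pow X" "u \<in> Pow X" "f t = f u" "t \<noteq> u"
    \<comment> \<open>With a second value \<open>b\<close>, independence for the two sets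
      \<open>t\<close> and \<open>u\<close> gives a point where \<open>f t\<close> is
      \<open>b\<close> and \<open>f u\<close> is \<open>c\<close>.\<close>
    obtain b where b: "b \<in> I" "b \<noteq> c" 
      using infinite_imp_nonempty[OF infinite_remove[OF I(1), of c]] by blast
    obtain F where F: "F \<in> \<F>1" using card1(2) by blast
    let ?t = "\<lambda>i::nat. if i = 0 then t else u"
    let ?a = "\<lambda>i::nat. if i = 0 then b else c"
    have "\<exists>B \<subseteq> F. |B| =o |X| \<and> (\<forall>x\<in>B. \<forall>i<2. f (?t i) x = ?a i)"
      by (rule indep[OF F]) (use tu b c in \<open>auto simp: inj_on_def\<close>)
    then obtain B where B: "|B| =o |X|" "\<forall>x\<in>B. \<forall>i<2. f (?t i) x = ?a i" by blast
    then obtain x where x: "x \<in> B" using ne by blast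
    have "f t x = b" "f u x = c" using B(2)[rule_format, OF x, of 0] B(2)[rule_format, OF x, of 1] by auto
    then show False using tu(3) b by simp
  qed
  show ?thesis
    unfolding strongly_algebrable_def
  proof (intro conjI exI[of _ "f ` Pow X"] allI ballI impI)
    show "SES X I \<F>1 - SES X I \<F>2 \<subseteq> X \<rightarrow>\<^sub>E UNIV" by (auto simp: SES_def)
    show "f ` Pow X \<subseteq> SES X I \<F>1 - SES X I \<F>2" using fE by blast
    have "|f ` Pow X| =o |Pow X|"
      using inj by (meson card_of_ordIsoI inj_on_imp_bij_betw ordIso_symmetric)
    moreover have "|Pow X| =o ctwo ^c |X|"
      using card_of_Pow_Func by (simp add: cexp_def ctwo_def Field_card_of)
    ultimately show "|f ` Pow X| =o ctwo ^c |X|" by (rule ordIso_transitive)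
    fix n and P :: "'k mpoly" and y
    assume n: "n \<ge> 1" and P: "P \<in> polys n"
      and A: "P \<noteq> 0 \<and> const_term P = 0 \<and> inj_on y {..<n} \<and> y ` {..<n} \<subseteq> f ` Pow X"
    then have "\<forall>i. \<exists>t. i < n \<longrightarrow> t \<subseteq> X \<and> y i = f t" by blast
    then obtain t where t: "\<And>i. i < n \<Longrightarrow> t i \<subseteq> X \<and> y i = f (t i)" by metis
    have "inj_on t {..<n}"
      using A t by (metis (mono_tags, lifting) inj_on_def lessThan_iff)
    moreover have "eval_poly_fun X P y = eval_poly_fun X P (\<lambda>i. f (t i))"
      unfolding eval_poly_fun_def by (intro restrict_ext eval_poly_cong[OF P]) (simp add: t)
    ultimately show "eval_poly_fun X P y \<in> SES X I \<F>1 - SES X I \<F>2 - {\<lambda>x\<in>X. 0}"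
      using main[OF n P nonconstantI, of t] A t by simp
  qed
qed

section \<open>Real and complex scalars\<close>

theorem theorem2p3:
  fixes X :: "'a set" and \<F>1 \<F>2 :: "'a set set"
  assumes "infinite X" and "|X| =o |X| ^c natLeq"
    and "\<F>1 \<subseteq> Pow X" and "\<F>2 \<subseteq> Pow X"
    and "|\<F>1| =o |X|" and "|\<F>2| =o |X|"
    and "\<forall>F\<in>\<F>1. |F| =o |X|" and "\<forall>F\<in>\<F>2. |F| =o |X|"
    and "\<exists>F2\<in>\<F>2. \<forall>F1\<in>\<F>1. |F1 - F2| =o |X|"
  shows "(\<forall>I :: real set. interior I \<noteq> {} \<longrightarrow>
            strongly_algebrable X (ctwo ^c |X| ) (SES X I \<F>1 - SES X I \<F>2)) \<and>
         (\<forall>I :: complex set. interior I \<noteq> {} \<longrightarrow>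
            strongly_algebrable X (ctwo ^c |X| ) (SES X I \<F>1 - SES X I \<F>2))"
proof -
  obtain F2 where F2: "F2 \<in> \<F>2" "\<And>F. F \<in> \<F>1 \<Longrightarrow> |F - F2| =o |X|" using assms(9) by blast
  have F2': "F2 \<subseteq> X" "F2 \<noteq> {}" "\<F>1 \<noteq> {}"
    using F2(1) assms(1,4,5,8) card_of_ordIso_finite by fastforce+
  \<comment> \<open>The continuum is at most 2^\<omega>, hence at most \<kappa>^\<omega> = \<kappa>;
    this bounds the size of \<open>I\<close> over both fields.\<close>
  have R: "|UNIV :: real set| \<le>o |X|"
    using card_of_real_ordLeq_nat_set card_of_nat_set_ordLeq[OF assms(2,1)] ordLeq_transitive by blast
  note C = card_of_complex_ordLeq[OF assms(1) R]
  have RI: "|I| \<le>o |X|" for I :: "real set"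
    using card_of_mono1[OF subset_UNIV] R by (rule ordLeq_transitive)
  have CI: "|I| \<le>o |X|" for I :: "complex set"
    using card_of_mono1[OF subset_UNIV] C by (rule ordLeq_transitive)
  note alg = strongly_algebrable_SES_Diff[OF assms(1-3) F2'(1) F2(1) F2'(2)
      ordIso_imp_ordLeq[OF assms(5)] F2'(3) F2(2)]
  show ?thesis
    \<comment> \<open>Finite sets have empty interior here, so \<open>I\<close> is infinite.\<close>
    by (intro conjI allI impI alg RI CI) (use empty_interior_finite in blast)+
qed

end
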